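(* For all strictly positive formulas $\varphi,\psi$: if $\varphi\vdash_{\mathbf{RC}}\psi$, then $\mathscr{T}(\varphi)\hookrightarrow^{*}\mathscr{T}(\psi)$ in the tree rewriting system $\mathsf{TRC}$.
   Context: Strictly positive formulas $\mathcal{L}^+$: $\varphi::=\top\mid p\mid\langle\alpha\rangle\varphi\mid(\varphi\wedge\varphi)$ with $p$ a propositional variable and $\alpha<\omega$. $\mathbf{K}^+$ has axioms $\varphi\vdash\varphi$, $\varphi\vdash\top$, $\varphi\wedge\psi\vdash\varphi$, $\varphi\wedge\psi\vdash\psi$, and rules: from $\varphi\vdash\psi$ and $\psi\vdash\chi$ infer $\varphi\vdash\chi$; from $\varphi\vdash\psi$ and $\varphi\vdash\chi$ infer $\varphi\vdash\psi\wedge\chi$; from $\varphi\vdash\psi$ infer $\langle\alpha\rangle\varphi\vdash\langle\alpha\rangle\psi$. $\mathbf{RC}$ extends $\mathbf{K}^+$ by axioms $\langle\alpha\rangle\langle\alpha\rangle\varphi\vdash\langle\alpha\rangle\varphi$; $\langle\alpha\rangle\varphi\vdash\langle\beta\rangle\varphi$ for $\alpha>\beta$; $\langle\alpha\rangle\varphi\wedge\langle\beta\rangle\psi\vdash\langle\alpha\rangle(\varphi\wedge\langle\beta\rangle\psi)$ for $\alpha>\beta$. Modal trees: recursively, pairs $\langle\Delta;\Gamma\rangle$ with $\Delta$ a finite list of propositional variables and $\Gamma$ a finite list of pairs $(\alpha,\mathtt{S})$, $\alpha<\omega$, $\mathtt{S}$ a modal tree. Sum: $\langle\Delta_1;\Gamma_1\rangle+\langle\Delta_2;\Gamma_2\rangle=\langle\Delta_1\frown\Delta_2;\Gamma_1\frown\Gamma_2\rangle$.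 Embedding $\mathscr{T}$: $\mathscr{T}(\top)=\langle\varnothing;\varnothing\rangle$, $\mathscr{T}(p)=\langle[p];\varnothing\rangle$, $\mathscr{T}(\langle\alpha\rangle\varphi)=\langle\varnothing;[(\alpha,\mathscr{T}(\varphi))]\rangle$, $\mathscr{T}(\varphi\wedge\psi)=\mathscr{T}(\varphi)+\mathscr{T}(\psi)$. Positions: $\mathrm{Pos}(\langle\Delta;\varnothing\rangle)=\{\epsilon\}$; $\mathrm{Pos}(\langle\Delta;[(\alpha_1,\mathtt{S}_1),\dots,(\alpha_n,\mathtt{S}_n)]\rangle)=\{\epsilon\}\cup\bigcup_{i=1}^n\{i\mathbf{k}\mid\mathbf{k}\in\mathrm{Pos}(\mathtt{S}_i)\}$. Subtree: $\mathtt{T}|_\epsilon=\mathtt{T}$, $\mathtt{T}|_{i\mathbf{r}}=\mathtt{S}_i|_{\mathbf{r}}$. Replacement: $\mathtt{T}[\mathtt{S}]_\epsilon=\mathtt{S}$, $\mathtt{T}[\mathtt{S}]_{i\mathbf{r}}$ is $\mathtt{T}$ with its $i$-th child $\mathtt{S}_i$ replaced by $\mathtt{S}_i[\mathtt{S}]_{\mathbf{r}}$ (same edge label). List operations, for $0<i,j\le|\Gamma|$: $\#_i\Gamma$ is the $i$-th element; $\Gamma^{-i}$ deletes it; $\Gamma^{+i}=(\#_i\Gamma)\frown\Gamma$; $\Gamma[x]_i$ replaces the $i$-th element by $x$; $\Gamma^{i\leftrightarrow j}$ swaps the $i$-th and $j$-th elements; similarly $\Delta^{-n},\Delta^{+n}$.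 $\mathsf{TRC}$ rules: for a modal tree $\mathtt{T}$, $\mathbf{k}\in\mathrm{Pos}(\mathtt{T})$ with $\mathtt{T}|_\mathbf{k}=\langle\Delta;\Gamma\rangle$: ($\rho^+$) $\mathtt{T}\hookrightarrow\mathtt{T}[\langle\Delta^{+i};\Gamma\rangle]_\mathbf{k}$, $0<i\le|\Delta|$; ($\rho^-$) $\mathtt{T}\hookrightarrow\mathtt{T}[\langle\Delta^{-i};\Gamma\rangle]_\mathbf{k}$; ($\sigma$) $\mathtt{T}\hookrightarrow\mathtt{T}[\langle\Delta;\Gamma^{i\leftrightarrow j}\rangle]_\mathbf{k}$, $i\neq j$; ($\pi^+$) $\mathtt{T}\hookrightarrow\mathtt{T}[\langle\Delta;\Gamma^{+i}\rangle]_\mathbf{k}$; ($\pi^-$) $\mathtt{T}\hookrightarrow\mathtt{T}[\langle\Delta;\Gamma^{-i}\rangle]_\mathbf{k}$; ($\mathfrak{4}$) if $\#_i\Gamma=(\beta,\langle\tilde\Delta;\tilde\Gamma\rangle)$ and $\#_j\tilde\Gamma=(\beta,\mathtt{S})$, then $\mathtt{T}\hookrightarrow\mathtt{T}[\langle\Delta;\Gamma[(\beta,\mathtt{S})]_i\rangle]_\mathbf{k}$; ($\lambda$) if $\#_i\Gamma=(\alpha,\mathtt{S})$ and $\alpha>\beta$, then $\mathtt{T}\hookrightarrow\mathtt{T}[\langle\Delta;\Gamma[(\beta,\mathtt{S})]_i\rangle]_\mathbf{k}$; ($\mathsf{J}$) if $i\ne j$, $\#_i\Gamma=(\alpha,\langle\tilde\Delta;\tilde\Gamma\rangle)$,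 $\#_j\Gamma=(\beta,\mathtt{S})$, $\alpha>\beta$, then $\mathtt{T}\hookrightarrow\mathtt{T}[\langle\Delta;(\Gamma[(\alpha,\langle\tilde\Delta;\tilde\Gamma\frown(\beta,\mathtt{S})\rangle)]_i)^{-j}\rangle]_\mathbf{k}$. $\hookrightarrow$ is the union of these relations and $\hookrightarrow^*$ its reflexive-transitive closure. *)

theory Defs
  imports Main
begin

section \<open>Strictly positive formulas and the reflection calculus\<close>

datatype 'p fm =
    Verum  (\<open>\<^bold>\<top>\<close>)
  | Var 'p
  | Dia nat "'p fm"  (\<open>\<^bold>\<langle>_\<^bold>\<rangle>_\<close> [0, 75] 75)
  | Conj "'p fm" "'p fm"  (infixr \<open>\<^bold>\<and>\<close> 70)

inductive RC :: "'p fm \<Rightarrow> 'p fm \<Rightarrow> bool"  (infix \<open>\<turnstile>\<^bsub>RC\<^esub>\<close> 50) where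
  refl: "\<phi> \<turnstile>\<^bsub>RC\<^esub> \<phi>"
| top: "\<phi> \<turnstile>\<^bsub>RC\<^esub> \<^bold>\<top>"
| conjE1: "\<phi> \<^bold>\<and> \<psi> \<turnstile>\<^bsub>RC\<^esub> \<phi>"
| conjE2: "\<phi> \<^bold>\<and> \<psi> \<turnstile>\<^bsub>RC\<^esub> \<psi>"
| cut: "\<phi> \<turnstile>\<^bsub>RC\<^esub> \<psi> \<Longrightarrow> \<psi> \<turnstile>\<^bsub>RC\<^esub> \<chi> \<Longrightarrow> \<phi> \<turnstile>\<^bsub>RC\<^esub> \<chi>"
| conjI: "\<phi> \<turnstile>\<^bsub>RC\<^esub> \<psi> \<Longrightarrow> \<phi> \<turnstile>\<^bsub>RC\<^esub> \<chi> \<Longrightarrow> \<phi> \<turnstile>\<^bsub>RC\<^esub> \<psi> \<^bold>\<and> \<chi>"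
| nec: "\<phi> \<turnstile>\<^bsub>RC\<^esub> \<psi> \<Longrightarrow> \<^bold>\<langle>\<alpha>\<^bold>\<rangle>\<phi> \<turnstile>\<^bsub>RC\<^esub> \<^bold>\<langle>\<alpha>\<^bold>\<rangle>\<psi>"
| four: "\<^bold>\<langle>\<alpha>\<^bold>\<rangle>\<^bold>\<langle>\<alpha>\<^bold>\<rangle>\<phi> \<turnstile>\<^bsub>RC\<^esub> \<^bold>\<langle>\<alpha>\<^bold>\<rangle>\<phi>"
| mono: "\<alpha> > \<beta> \<Longrightarrow> \<^bold>\<langle>\<alpha>\<^bold>\<rangle>\<phi> \<turnstile>\<^bsub>RC\<^esub> \<^bold>\<langle>\<beta>\<^bold>\<rangle>\<phi>"
| J: "\<alpha> > \<beta> \<Longrightarrow> \<^bold>\<langle>\<alpha>\<^bold>\<rangle>\<phi> \<^bold>\<and> \<^bold>\<langle>\<beta>\<^bold>\<rangle>\<psi> \<turnstile>\<^bsub>RC\<^esub> \<^bold>\<langle>\<alpha>\<^bold>\<rangle>(\<phi> \<^bold>\<and> \<^bold>\<langle>\<beta>\<^bold>\<rangle>\<psi>)"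

section \<open>Modal trees\<close>

datatype 'p mtree = MTree "'p list" "(nat \<times> 'p mtree) list"

fun tree_sum :: "'p mtree \<Rightarrow> 'p mtree \<Rightarrow> 'p mtree"  (infixr \<open>\<^bold>+\<close> 65) where
  "MTree \<Delta>\<^sub>1 \<Gamma>\<^sub>1 \<^bold>+ MTree \<Delta>\<^sub>2 \<Gamma>\<^sub>2 = MTree (\<Delta>\<^sub>1 @ \<Delta>\<^sub>2) (\<Gamma>\<^sub>1 @ \<Gamma>\<^sub>2)"

primrec tree_of :: "'p fm \<Rightarrow> 'p mtree"  (\<open>\<T>\<close>) where
  "\<T> \<^bold>\<top> = MTree [] []"
| "\<T> (Var p) = MTree [p] []"
| "\<T> (\<^bold>\<langle>\<alpha>\<^bold>\<rangle>\<phi>) = MTree [] [(\<alpha>, \<T> \<phi>)]"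
| "\<T> (\<phi> \<^bold>\<and> \<psi>) = \<T> \<phi> \<^bold>+ \<T> \<psi>"

section \<open>List operations\<close>

text \<open>All indices are counted from 1; the operations are used only for indices between 1 and
  the length of the list.\<close>

definition elem_at :: "nat \<Rightarrow> 'a list \<Rightarrow> 'a" where
  "elem_at i xs = xs ! (i - 1)"

definition delete_at :: "nat \<Rightarrow> 'a list \<Rightarrow> 'a list" where
  "delete_at i xs = take (i - 1) xs @ drop i xs"

definition duplicate_at :: "nat \<Rightarrow> 'a list \<Rightarrow> 'a list" where
  "duplicate_at i xs = elem_at i xs # xs"

definition replace_at :: "nat \<Rightarrow> 'a \<Rightarrow> 'a list \<Rightarrow> 'a list" where
  "replace_at i x xs = xs[i - 1 := x]"

definition swap_at :: "nat \<Rightarrow> nat \<Rightarrow> 'a list \<Rightarrow> 'a list" where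
  "swap_at i j xs = replace_at j (elem_at i xs) (replace_at i (elem_at j xs) xs)"

section \<open>Positions, subtrees, replacement\<close>

function Pos :: "'p mtree \<Rightarrow> nat list set" where
  "Pos (MTree \<Delta> \<Gamma>) = {[]} \<union> (\<Union>i\<in>{1..length \<Gamma>}. {i # k |k. k \<in> Pos (snd (elem_at i \<Gamma>))})"
  by pat_completeness auto
termination
proof (relation "measure size")
  fix \<Delta> :: "'p list" and \<Gamma> :: "(nat \<times> 'p mtree) list" and i
  assume "i \<in> {1..length \<Gamma>}"
  then have "elem_at i \<Gamma> \<in> set \<Gamma>"
    by (auto simp: elem_at_def)
  then obtain xs ys where "\<Gamma> = xs @ elem_at i \<Gamma> # ys"
    by (meson split_list)
  then have "size (MTree \<Delta> \<Gamma>) = size (MTree \<Delta> (xs @ elem_at i \<Gamma> # ys))"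
    by simp
  then have "size (snd (elem_at i \<Gamma>)) < size (MTree \<Delta> \<Gamma>)"
    by (cases "elem_at i \<Gamma>") simp
  then show "(snd (elem_at i \<Gamma>), MTree \<Delta> \<Gamma>) \<in> measure size"
    by simp
qed simp

text \<open>Subtree and replacement are meaningful only at positions of the tree.\<close>

fun subtree :: "'p mtree \<Rightarrow> nat list \<Rightarrow> 'p mtree" where
  "subtree T [] = T"
| "subtree (MTree \<Delta> \<Gamma>) (i # r) = subtree (snd (elem_at i \<Gamma>)) r"

fun replace_tree :: "'p mtree \<Rightarrow> 'p mtree \<Rightarrow> nat list \<Rightarrow> 'p mtree" where
  "replace_tree T S [] = S"
| "replace_tree (MTree \<Delta> \<Gamma>) S (i # r) =
     MTree \<Delta> (replace_at i (fst (elem_at i \<Gamma>), replace_tree (snd (elem_at i \<Gamma>)) S r) \<Gamma>)"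

section \<open>The tree rewriting system\<close>

inductive TRC :: "'p mtree \<Rightarrow> 'p mtree \<Rightarrow> bool"  (infix \<open>\<hookrightarrow>\<close> 50) where
  rho_plus:
    "\<lbrakk>k \<in> Pos T; subtree T k = MTree \<Delta> \<Gamma>; 0 < i; i \<le> length \<Delta>\<rbrakk>
      \<Longrightarrow> T \<hookrightarrow> replace_tree T (MTree (duplicate_at i \<Delta>) \<Gamma>) k"
| rho_minus:
    "\<lbrakk>k \<in> Pos T; subtree T k = MTree \<Delta> \<Gamma>; 0 < i; i \<le> length \<Delta>\<rbrakk>
      \<Longrightarrow> T \<hookrightarrow> replace_tree T (MTree (delete_at i \<Delta>) \<Gamma>) k"
| sigma:
    "\<lbrakk>k \<in> Pos T; subtree T k = MTree \<Delta> \<Gamma>; 0 < i; i \<le> length \<Gamma>; 0 < j; j \<le> length \<Gamma>; i \<noteq> j\<rbrakk>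
      \<Longrightarrow> T \<hookrightarrow> replace_tree T (MTree \<Delta> (swap_at i j \<Gamma>)) k"
| pi_plus:
    "\<lbrakk>k \<in> Pos T; subtree T k = MTree \<Delta> \<Gamma>; 0 < i; i \<le> length \<Gamma>\<rbrakk>
      \<Longrightarrow> T \<hookrightarrow> replace_tree T (MTree \<Delta> (duplicate_at i \<Gamma>)) k"
| pi_minus:
    "\<lbrakk>k \<in> Pos T; subtree T k = MTree \<Delta> \<Gamma>; 0 < i; i \<le> length \<Gamma>\<rbrakk>
      \<Longrightarrow> T \<hookrightarrow> replace_tree T (MTree \<Delta> (delete_at i \<Gamma>)) k"
| four:
    "\<lbrakk>k \<in> Pos T; subtree T k = MTree \<Delta> \<Gamma>; 0 < i; i \<le> length \<Gamma>;
      elem_at i \<Gamma> = (\<beta>, MTree \<Delta>' \<Gamma>'); 0 < j; j \<le> length \<Gamma>'; elem_at j \<Gamma>' = (\<beta>, S)\<rbrakk>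
      \<Longrightarrow> T \<hookrightarrow> replace_tree T (MTree \<Delta> (replace_at i (\<beta>, S) \<Gamma>)) k"
| lambda:
    "\<lbrakk>k \<in> Pos T; subtree T k = MTree \<Delta> \<Gamma>; 0 < i; i \<le> length \<Gamma>;
      elem_at i \<Gamma> = (\<alpha>, S); \<alpha> > \<beta>\<rbrakk>
      \<Longrightarrow> T \<hookrightarrow> replace_tree T (MTree \<Delta> (replace_at i (\<beta>, S) \<Gamma>)) k"
| J:
    "\<lbrakk>k \<in> Pos T; subtree T k = MTree \<Delta> \<Gamma>; 0 < i; i \<le> length \<Gamma>; 0 < j; j \<le> length \<Gamma>; i \<noteq> j;
      elem_at i \<Gamma> = (\<alpha>, MTree \<Delta>' \<Gamma>'); elem_at j \<Gamma> = (\<beta>, S); \<alpha> > \<beta>\<rbrakk>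
      \<Longrightarrow> T \<hookrightarrow> replace_tree T
            (MTree \<Delta> (delete_at j (replace_at i (\<alpha>, MTree \<Delta>' (\<Gamma>' @ [(\<beta>, S)])) \<Gamma>))) k"

abbreviation TRC_star :: "'p mtree \<Rightarrow> 'p mtree \<Rightarrow> bool"  (infix \<open>\<hookrightarrow>\<^sup>*\<close> 50) where
  "T \<hookrightarrow>\<^sup>* S \<equiv> TRC\<^sup>*\<^sup>* T S"

end

theory Submission
  imports Defs
begin

text \<open>Duplicating and deleting list elements lets a node rewrite to any node whose labels and
  children occur, as sets, among its own; this covers \<open>\<top>\<close>, the projections, the commutativity of
  the sum and the passage from \<open>T\<close> to \<open>T \<^bold>+ T\<close>. Rewriting is compatible with sums, first on the left
  and then on the right by commutativity, which gives conjunction introduction.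
  The modal axioms are single rewrite steps at the root.\<close>

text \<open>In a sum the lists of the right summand are suffixes. This and the analogous lemmas
  below let an operation at an index of the left summand pass through such a suffix.\<close>

lemma delete_at_append: "0 < i \<Longrightarrow> i \<le> length xs \<Longrightarrow> delete_at i (xs @ ys) = delete_at i xs @ ys"
  by (simp add: delete_at_def)

lemma elem_at_append: "0 < i \<Longrightarrow> i \<le> length xs \<Longrightarrow> elem_at i (xs @ ys) = elem_at i xs"
  by (auto simp: elem_at_def nth_append)

lemma duplicate_at_append:
  "0 < i \<Longrightarrow> i \<le> length xs \<Longrightarrow> duplicate_at i (xs @ ys) = duplicate_at i xs @ ys"
  by (simp add: duplicate_at_def elem_at_append)

lemma replace_at_append:
  "0 < i \<Longrightarrow> i \<le> length xs \<Longrightarrow> replace_at i x (xs @ ys) = replace_at i x xs @ ys"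
  by (auto simp: replace_at_def list_update_append)

lemma length_replace_at [simp]: "length (replace_at i x xs) = length xs"
  by (simp add: replace_at_def)

lemma swap_at_append:
  "\<lbrakk>0 < i; i \<le> length xs; 0 < j; j \<le> length xs\<rbrakk> \<Longrightarrow> swap_at i j (xs @ ys) = swap_at i j xs @ ys"
  by (simp add: swap_at_def elem_at_append replace_at_append)

lemmas list_op_append =
  delete_at_append elem_at_append duplicate_at_append replace_at_append swap_at_append

lemma in_set_elem_at:
  assumes "x \<in> set xs"
  obtains i where "0 < i" "i \<le> length xs" "elem_at i xs = x"
proof -
  from assms obtain n where "n < length xs" "xs ! n = x"
    by (auto simp: in_set_conv_nth)
  \<comment> \<open>The index is \<open>Suc n\<close> because \<open>elem_at\<close> counts from
    1.\<close>
  then show thesis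
    using that [of "Suc n"] by (simp add: elem_at_def)
qed

text \<open>Since \<open>rho_plus\<close> puts its copy at the front, \<open>\<Delta>'\<close> is
  built from its last entry to its first, each entry being copied from the list obtained so
  far.\<close>

lemma TRC_prepend_labels: "set \<Delta>' \<subseteq> set \<Delta> \<Longrightarrow> MTree \<Delta> \<Gamma> \<hookrightarrow>\<^sup>* MTree (\<Delta>' @ \<Delta>) \<Gamma>"
proof (induction \<Delta>')
  case (Cons p \<Delta>')
  then have "p \<in> set (\<Delta>' @ \<Delta>)"
    by simp
  then obtain i where "0 < i" "i \<le> length (\<Delta>' @ \<Delta>)" "elem_at i (\<Delta>' @ \<Delta>) = p"
    by (rule in_set_elem_at)
  then have "MTree (\<Delta>' @ \<Delta>) \<Gamma> \<hookrightarrow> MTree (p # \<Delta>' @ \<Delta>) \<Gamma>"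
    using TRC.rho_plus [of "[]" "MTree (\<Delta>' @ \<Delta>) \<Gamma>" _ _ i] by (simp add: duplicate_at_def)
  with Cons show ?case
    by simp
qed simp

lemma TRC_prepend_children: "set \<Gamma>' \<subseteq> set \<Gamma> \<Longrightarrow> MTree \<Delta> \<Gamma> \<hookrightarrow>\<^sup>* MTree \<Delta> (\<Gamma>' @ \<Gamma>)"
proof (induction \<Gamma>')
  case (Cons c \<Gamma>')
  then have "c \<in> set (\<Gamma>' @ \<Gamma>)"
    by simp
  then obtain i where "0 < i" "i \<le> length (\<Gamma>' @ \<Gamma>)" "elem_at i (\<Gamma>' @ \<Gamma>) = c"
    by (rule in_set_elem_at)
  then have "MTree \<Delta> (\<Gamma>' @ \<Gamma>) \<hookrightarrow> MTree \<Delta> (c # \<Gamma>' @ \<Gamma>)"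
    using TRC.pi_plus [of "[]" "MTree \<Delta> (\<Gamma>' @ \<Gamma>)" _ _ i] by (simp add: duplicate_at_def)
  with Cons show ?case
    by simp
qed simp

lemma TRC_drop_labels: "MTree (\<Delta>' @ \<Delta>) \<Gamma> \<hookrightarrow>\<^sup>* MTree \<Delta>' \<Gamma>"
proof (induction \<Delta>)
  case (Cons p \<Delta>)
  \<comment> \<open>Counted from 1, the first entry behind \<open>\<Delta>'\<close> has index
    \<open>Suc (length \<Delta>')\<close>.\<close>
  have "MTree (\<Delta>' @ p # \<Delta>) \<Gamma> \<hookrightarrow> MTree (\<Delta>' @ \<Delta>) \<Gamma>"
    using TRC.rho_minus [of "[]" "MTree (\<Delta>' @ p # \<Delta>) \<Gamma>" _ _ "Suc (length \<Delta>')"]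
    by (simp add: delete_at_def)
  with Cons show ?case
    by (simp add: converse_rtranclp_into_rtranclp)
qed simp

lemma TRC_drop_children: "MTree \<Delta> (\<Gamma>' @ \<Gamma>) \<hookrightarrow>\<^sup>* MTree \<Delta> \<Gamma>'"
proof (induction \<Gamma>)
  case (Cons c \<Gamma>)
  have "MTree \<Delta> (\<Gamma>' @ c # \<Gamma>) \<hookrightarrow> MTree \<Delta> (\<Gamma>' @ \<Gamma>)"
    using TRC.pi_minus [of "[]" "MTree \<Delta> (\<Gamma>' @ c # \<Gamma>)" _ _ "Suc (length \<Gamma>')"]
    by (simp add: delete_at_def)
  with Cons show ?case
    by (simp add: converse_rtranclp_into_rtranclp)
qed simp

text \<open>The target list is copied in front of the old one and the old one is then dropped, so
  any order and multiplicity is reached; labels come first, then children.\<close>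

lemma TRC_subset:
  assumes "set \<Delta>' \<subseteq> set \<Delta>" "set \<Gamma>' \<subseteq> set \<Gamma>"
  shows "MTree \<Delta> \<Gamma> \<hookrightarrow>\<^sup>* MTree \<Delta>' \<Gamma>'"
proof -
  have "MTree \<Delta> \<Gamma> \<hookrightarrow>\<^sup>* MTree (\<Delta>' @ \<Delta>) \<Gamma>"
    using assms(1) by (rule TRC_prepend_labels)
  also have "TRC\<^sup>*\<^sup>* \<dots> (MTree \<Delta>' \<Gamma>)"
    by (rule TRC_drop_labels)
  also have "TRC\<^sup>*\<^sup>* \<dots> (MTree \<Delta>' (\<Gamma>' @ \<Gamma>))"
    using assms(2) by (rule TRC_prepend_children)
  also have "TRC\<^sup>*\<^sup>* \<dots> (MTree \<Delta>' \<Gamma>')"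
    by (rule TRC_drop_children)
  finally show ?thesis .
qed

lemma TRC_sum_left: "T \<^bold>+ S \<hookrightarrow>\<^sup>* T"
  by (cases T; cases S) (simp add: TRC_subset)

lemma TRC_sum_right: "T \<^bold>+ S \<hookrightarrow>\<^sup>* S"
  by (cases T; cases S) (simp add: TRC_subset)

lemma TRC_sum_commute: "T \<^bold>+ S \<hookrightarrow>\<^sup>* S \<^bold>+ T"
  by (cases T; cases S) (simp add: TRC_subset)

lemma TRC_sum_self: "T \<hookrightarrow>\<^sup>* T \<^bold>+ T"
  by (cases T) (simp add: TRC_subset)

text \<open>A step at position \<open>k\<close> of \<open>T\<close> becomes the same step at
  \<open>1 # k\<close>, because replacement below an edge keeps its label.\<close>

lemma TRC_child:
  assumes "T \<hookrightarrow> S"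
  shows "MTree [] [(\<alpha>, T)] \<hookrightarrow> MTree [] [(\<alpha>, S)]"
proof -
  have pos: "1 # k \<in> Pos (MTree [] [(\<alpha>, T)])" if "k \<in> Pos T" for k
    using that by (simp add: elem_at_def)
  have sub: "subtree (MTree [] [(\<alpha>, T)]) (1 # k) = subtree T k" for k
    by (simp add: elem_at_def)
  have rep: "MTree [] [(\<alpha>, replace_tree T U k)] = replace_tree (MTree [] [(\<alpha>, T)]) U (1 # k)" for U k
    by (simp add: elem_at_def replace_at_def)
  \<comment> \<open>Folding with \<open>rep\<close> exposes a \<open>replace_tree\<close> to which
    the same rule applies. Where conclusions overlap, as for \<open>four\<close> and
    \<open>lambda\<close>, the premises decide which rule fits.\<close>
  from assms show ?thesis
    by cases (simp only: rep, rule TRC.intros, erule pos, simp only: sub, assumption+)+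
qed

lemma TRC_children:
  assumes "T \<hookrightarrow>\<^sup>* S"
  shows "MTree [] [(\<alpha>, T)] \<hookrightarrow>\<^sup>* MTree [] [(\<alpha>, S)]"
  using assms by induction (auto intro: TRC_child rtranclp.rtrancl_into_rtrancl)

text \<open>A single step suffices because \<open>duplicate_at\<close> puts the copy at the front of the list;
  in a right summand it would land in front of the left one.\<close>

lemma TRC_sum_mono1_step:
  assumes "T \<hookrightarrow> S"
  shows "T \<^bold>+ U \<hookrightarrow> S \<^bold>+ U"
proof -
  obtain \<Delta>\<^sub>U \<Gamma>\<^sub>U where U: "U = MTree \<Delta>\<^sub>U \<Gamma>\<^sub>U"
    by (cases U)
  \<comment> \<open>\<open>D k\<close> and \<open>G k\<close> are what \<open>U\<close> adds to the
    node at position \<open>k\<close>: its lists at the root, and nothing below, where the sum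
    leaves the children of \<open>T\<close> intact.\<close>
  define D where "D k = (if k = [] then \<Delta>\<^sub>U else [])" for k :: "nat list"
  define G where "G k = (if k = [] then \<Gamma>\<^sub>U else [])" for k :: "nat list"
  \<comment> \<open>The children of \<open>T\<close> come first in the sum and so keep their
    indices.\<close>
  have pos: "k \<in> Pos (T \<^bold>+ U)" if "k \<in> Pos T" for k
    using that U by (cases T; cases k) (auto simp: elem_at_append)
  have sub: "subtree (T \<^bold>+ U) k = MTree (\<Delta> @ D k) (\<Gamma> @ G k)"
    if "k \<in> Pos T" "subtree T k = MTree \<Delta> \<Gamma>" for k \<Delta> \<Gamma>
    using that U by (cases T; cases k) (auto simp: D_def G_def elem_at_append)
  have rep: "replace_tree T (MTree \<Delta> \<Gamma>) k \<^bold>+ U = replace_tree (T \<^bold>+ U) (MTree (\<Delta> @ D k) (\<Gamma> @ G k)) k"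
    if "k \<in> Pos T" for k \<Delta> \<Gamma>
    using that U by (cases T; cases k) (auto simp: D_def G_def elem_at_append replace_at_append)
  \<comment> \<open>In each case the same rule fires with the same indices on the lists extended by
    \<open>D k\<close> and \<open>G k\<close>; \<open>list_op_append\<close> then splits the
    suffixes off again.\<close>
  from assms show ?thesis
  proof cases
    case (rho_plus k \<Delta> \<Gamma> i)
    with TRC.rho_plus [OF pos sub, of k \<Delta> \<Gamma> i] show ?thesis
      by (simp add: rep list_op_append)
  next
    case (rho_minus k \<Delta> \<Gamma> i)
    with TRC.rho_minus [OF pos sub, of k \<Delta> \<Gamma> i] show ?thesis
      by (simp add: rep list_op_append)
  next
    case (sigma k \<Delta> \<Gamma> i j)
    with TRC.sigma [OF pos sub, of k \<Delta> \<Gamma> i j] show ?thesis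
      by (simp add: rep list_op_append)
  next
    case (pi_plus k \<Delta> \<Gamma> i)
    with TRC.pi_plus [OF pos sub, of k \<Delta> \<Gamma> i] show ?thesis
      by (simp add: rep list_op_append)
  next
    case (pi_minus k \<Delta> \<Gamma> i)
    with TRC.pi_minus [OF pos sub, of k \<Delta> \<Gamma> i] show ?thesis
      by (simp add: rep list_op_append)
  next
    case (four k \<Delta> \<Gamma> i \<beta> \<Delta>' \<Gamma>' j S')
    with TRC.four [OF pos sub, of k \<Delta> \<Gamma> i \<beta> \<Delta>' \<Gamma>' j S'] show ?thesis
      by (simp add: rep list_op_append)
  next
    case (lambda k \<Delta> \<Gamma> i \<alpha> S' \<beta>)
    with TRC.lambda [OF pos sub, of k \<Delta> \<Gamma> i \<alpha> S' \<beta>] show ?thesis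
      by (simp add: rep list_op_append)
  next
    case (J k \<Delta> \<Gamma> i j \<alpha> \<Delta>' \<Gamma>' \<beta> S')
    \<comment> \<open>Here the deletion acts on an updated list, so its index bound needs
      \<open>length_replace_at\<close>.\<close>
    with TRC.J [OF pos sub, of k \<Delta> \<Gamma> i j \<alpha> \<Delta>' \<Gamma>' \<beta> S'] show ?thesis
      by (simp add: rep list_op_append)
  qed
qed

lemma TRC_sum_mono1:
  assumes "T \<hookrightarrow>\<^sup>* S"
  shows "T \<^bold>+ U \<hookrightarrow>\<^sup>* S \<^bold>+ U"
  using assms by induction (auto intro: TRC_sum_mono1_step rtranclp.rtrancl_into_rtrancl)

lemma TRC_sum_mono2:
  assumes "T \<hookrightarrow>\<^sup>* S"
  shows "U \<^bold>+ T \<hookrightarrow>\<^sup>* U \<^bold>+ S"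
  using TRC_sum_commute TRC_sum_mono1 [OF assms] by (meson rtranclp_trans)

theorem mainTheorem2:
  fixes \<phi> \<psi> :: "'p fm"
  assumes "\<phi> \<turnstile>\<^bsub>RC\<^esub> \<psi>"
  shows "\<T> \<phi> \<hookrightarrow>\<^sup>* \<T> \<psi>"
  using assms
proof induction
  case (refl \<phi>)
  show ?case
    by simp
next
  case (top \<phi>)
  show ?case
    by (cases "\<T> \<phi>") (simp add: TRC_subset)
next
  case (conjE1 \<phi> \<psi>)
  show ?case
    by (simp add: TRC_sum_left)
next
  case (conjE2 \<phi> \<psi>)
  show ?case
    by (simp add: TRC_sum_right)
next
  case (cut \<phi> \<psi> \<chi>)
  then show ?case
    by simp
next
  case (conjI \<phi> \<psi> \<chi>)
  \<comment> \<open>One copy is made for each conjunct.\<close>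
  have "\<T> \<phi> \<hookrightarrow>\<^sup>* \<T> \<phi> \<^bold>+ \<T> \<phi>"
    by (rule TRC_sum_self)
  also have "TRC\<^sup>*\<^sup>* \<dots> (\<T> \<psi> \<^bold>+ \<T> \<phi>)"
    using conjI.IH(1) by (rule TRC_sum_mono1)
  also have "TRC\<^sup>*\<^sup>* \<dots> (\<T> \<psi> \<^bold>+ \<T> \<chi>)"
    using conjI.IH(2) by (rule TRC_sum_mono2)
  finally show ?case
    by simp
next
  case (nec \<phi> \<psi> \<alpha>)
  then show ?case
    by (simp add: TRC_children)
next
  case (four \<alpha> \<phi>)
  have "\<T> (\<^bold>\<langle>\<alpha>\<^bold>\<rangle>\<^bold>\<langle>\<alpha>\<^bold>\<rangle>\<phi>) \<hookrightarrow> \<T> (\<^bold>\<langle>\<alpha>\<^bold>\<rangle>\<phi>)"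
    using TRC.four [of "[]" "\<T> (\<^bold>\<langle>\<alpha>\<^bold>\<rangle>\<^bold>\<langle>\<alpha>\<^bold>\<rangle>\<phi>)" _ _ 1 \<alpha> _ _ 1]
    by (simp add: elem_at_def replace_at_def)
  then show ?case ..
next
  case (mono \<alpha> \<beta> \<phi>)
  then have "\<T> (\<^bold>\<langle>\<alpha>\<^bold>\<rangle>\<phi>) \<hookrightarrow> \<T> (\<^bold>\<langle>\<beta>\<^bold>\<rangle>\<phi>)"
    using TRC.lambda [of "[]" "\<T> (\<^bold>\<langle>\<alpha>\<^bold>\<rangle>\<phi>)" _ _ 1]
    by (simp add: elem_at_def replace_at_def)
  then show ?case ..
next
  case (J \<alpha> \<beta> \<phi> \<psi>)
  obtain \<Delta> \<Gamma> where "\<T> \<phi> = MTree \<Delta> \<Gamma>"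
    by (cases "\<T> \<phi>")
  \<comment> \<open>The rule appends the second child of the root at the end of
    \<open>\<Gamma>\<close>, which is where the sum of \<open>\<T> \<phi>\<close> with the one-edge
    tree puts it. The explicit form of \<open>\<T> \<phi>\<close> lets \<open>tree_sum\<close>
    compute.\<close>
  with J have "\<T> (\<^bold>\<langle>\<alpha>\<^bold>\<rangle>\<phi> \<^bold>\<and> \<^bold>\<langle>\<beta>\<^bold>\<rangle>\<psi>) \<hookrightarrow> \<T> (\<^bold>\<langle>\<alpha>\<^bold>\<rangle>(\<phi> \<^bold>\<and> \<^bold>\<langle>\<beta>\<^bold>\<rangle>\<psi>))"
    using TRC.J [of "[]" "\<T> (\<^bold>\<langle>\<alpha>\<^bold>\<rangle>\<phi> \<^bold>\<and> \<^bold>\<langle>\<beta>\<^bold>\<rangle>\<psi>)" "[]"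
        "[(\<alpha>, MTree \<Delta> \<Gamma>), (\<beta>, \<T> \<psi>)]" 1 2 \<alpha> \<Delta> \<Gamma> \<beta> "\<T> \<psi>"]
    by (simp add: elem_at_def replace_at_def delete_at_def)
  then show ?case ..
qed

end
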